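(* Let $F$ be a one-dimensional tropical fan in $\mathbb{R}^n$ whose rays span $\mathbb{R}^n$. Let $P$ be a gallery class of $F$ with at least two rays, and write $P=\{\mathbb{R}_+v_0,\mathbb{R}_+v_1,\dots,\mathbb{R}_+v_k\}$, where $v_0,\dots,v_k$ are the primitive generators of its $k+1$ distinct rays. For $i\ne j$ in $\{0,\dots,k\}$ let $l_{ij}\in(\mathbb{Z}^n)^\vee$ be the unique functional such that $g_{l_{ij}}(v_i,v_j)\in\mathrm{Gly}(F)$. Then for every $i\in\{0,\dots,k\}$ the set $$\mathscr{M}(v_i):=\{M \text{ a non-negative TR function on }\mathbb{R}^n\mid M\cdot F=1,\ M(v_i)=1\}$$ is equal to $$\{M\text{ a non-negative TR function on }\mathbb{R}^n\mid 0<M\le M_{\max}(i)\},$$ where $M_{\max}(i):=\max\big(0,\ l_{ij}\ (0\le j\le k,\ j\ne i)\big)$. Here $\le$ is the pointwise order and $0<M$ means $M\ge 0$ and $M$ is not identically $0$.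
   Context: A one-dimensional tropical fan $F$ in $\mathbb{R}^n$ consists of finitely many distinct rays $\mathbb{R}_+v$ (and the origin), each with primitive generator $v\in\mathbb{Z}^n$ and a positive integer weight $\omega_v$, satisfying the balancing condition $\sum_v\omega_vv=0$. A tropical regular (TR) function on $\mathbb{R}^n$ is $\max(l_1,\dots,l_m)$ with $l_i\in(\mathbb{Z}^n)^\vee$; a non-negative TR function is one of the form $\max(0,l_1,\dots,l_m)$. The intersection number is $M\cdot F=\sum_v\omega_vM(v)$, the sum over the primitive generators of $F$. Galleries: for $l\in(\mathbb{Z}^n)^\vee$ with $\max(0,l)\cdot F=1$, the gallery of $F$ over $\max(0,l)$ is the set of rays $\mathbb{R}_+v$ of $F$ with $|l(v)|=1$. This always consists of two rays $\mathbb{R}_+v_a,\mathbb{R}_+v_b$ with $l(v_a)=1$, $l(v_b)=-1$, both of weight $1$, and $l(v)=0$ for all other primitive generators $v$ of $F$; it is denoted $g_l(v_a,v_b)$. $\mathrm{Gly}(F)$ is the set of galleries of $F$. The gallery $\{\mathbb{R}_+v_a,\mathbb{R}_+v_b\}$ determines $l$ once the ordering $l(v_a)=1$, $l(v_b)=-1$ is fixed. The relation on rays "equal, or together forming a gallery of $F$" is an equivalence relation; its equivalence classes are called gallery classes here (so any two distinct rays in the same class form a gallery). *)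

theory Defs
  imports "HOL-Analysis.Analysis"
begin

definition integral_vector :: "real ^ 'n \<Rightarrow> bool" where
  "integral_vector v \<longleftrightarrow> (\<forall>i. v $ i \<in> \<int>)"

definition primitive_vector :: "real ^ 'n \<Rightarrow> bool" where
  "primitive_vector v \<longleftrightarrow> integral_vector v \<and> v \<noteq> 0 \<and>
     (\<forall>(d::nat) u. integral_vector u \<and> v = of_nat d *\<^sub>R u \<longrightarrow> d = 1)"

text \<open>The elements of the dual lattice, regarded as linear functionals on the ambient real space.\<close>

definition dual_lattice :: "(real ^ 'n \<Rightarrow> real) set" where
  "dual_lattice = {l. linear l \<and> (\<forall>x. integral_vector x \<longrightarrow> l x \<in> \<int>)}"

definition ray :: "real ^ 'n \<Rightarrow> (real ^ 'n) set" where
  "ray v = {t *\<^sub>R v | t. t \<ge> 0}"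

text \<open>
  A one-dimensional tropical fan is given by the set \<open>V\<close> of the primitive generators of its rays
  and the weights \<open>\<omega>\<close> of the rays. As each ray has exactly one primitive generator, distinct
  elements of \<open>V\<close> span distinct rays. Values of \<open>\<omega>\<close> outside \<open>V\<close> are irrelevant.
\<close>

definition tropical_fan :: "(real ^ 'n) set \<Rightarrow> (real ^ 'n \<Rightarrow> nat) \<Rightarrow> bool" where
  "tropical_fan V \<omega> \<longleftrightarrow> finite V \<and> (\<forall>v\<in>V. primitive_vector v \<and> \<omega> v > 0) \<and>
     (\<Sum>v\<in>V. of_nat (\<omega> v) *\<^sub>R v) = 0"

definition rays :: "(real ^ 'n) set \<Rightarrow> (real ^ 'n) set set" where
  "rays V = ray ` V"

text \<open>\<open>L\<close> may be empty; this only yields the zero function, which is also \<open>max(0, 0)\<close>.\<close>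

definition nonneg_TR :: "(real ^ 'n \<Rightarrow> real) \<Rightarrow> bool" where
  "nonneg_TR M \<longleftrightarrow> (\<exists>L. finite L \<and> L \<subseteq> dual_lattice \<and>
     M = (\<lambda>x. Max (insert 0 ((\<lambda>l. l x) ` L))))"

definition intersection_number ::
    "(real ^ 'n \<Rightarrow> real) \<Rightarrow> (real ^ 'n) set \<Rightarrow> (real ^ 'n \<Rightarrow> nat) \<Rightarrow> real" where
  "intersection_number M V \<omega> = (\<Sum>v\<in>V. of_nat (\<omega> v) * M v)"

text \<open>The functionals over which a gallery is defined.\<close>

definition gallery_functionals ::
    "(real ^ 'n) set \<Rightarrow> (real ^ 'n \<Rightarrow> nat) \<Rightarrow> (real ^ 'n \<Rightarrow> real) set" where
  "gallery_functionals V \<omega> =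
     {l \<in> dual_lattice. intersection_number (\<lambda>x. max 0 (l x)) V \<omega> = 1}"

definition gallery :: "(real ^ 'n) set \<Rightarrow> (real ^ 'n \<Rightarrow> real) \<Rightarrow> (real ^ 'n) set set" where
  "gallery V l = {ray v | v. v \<in> V \<and> \<bar>l v\<bar> = 1}"

definition Gly :: "(real ^ 'n) set \<Rightarrow> (real ^ 'n \<Rightarrow> nat) \<Rightarrow> (real ^ 'n) set set set" where
  "Gly V \<omega> = gallery V ` gallery_functionals V \<omega>"

text \<open>\<open>is_gallery V \<omega> l a b\<close> says that \<open>g\<^sub>l(a, b)\<close> is a gallery of the fan.\<close>

definition is_gallery ::
    "(real ^ 'n) set \<Rightarrow> (real ^ 'n \<Rightarrow> nat) \<Rightarrow> (real ^ 'n \<Rightarrow> real) \<Rightarrow> real ^ 'n \<Rightarrow> real ^ 'n \<Rightarrow> bool" where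
  "is_gallery V \<omega> l a b \<longleftrightarrow> a \<in> V \<and> b \<in> V \<and> l \<in> gallery_functionals V \<omega> \<and>
     gallery V l = {ray a, ray b} \<and> l a = 1 \<and> l b = - 1"

text \<open>
  The functional \<open>l\<close> with \<open>g\<^sub>l(a, b)\<close> a gallery. It is well defined if the rays span the space
  and the rays of \<open>a\<close> and \<open>b\<close> form a gallery.
\<close>

definition gallery_functional ::
    "(real ^ 'n) set \<Rightarrow> (real ^ 'n \<Rightarrow> nat) \<Rightarrow> real ^ 'n \<Rightarrow> real ^ 'n \<Rightarrow> (real ^ 'n \<Rightarrow> real)" where
  "gallery_functional V \<omega> a b = (THE l. is_gallery V \<omega> l a b)"

definition gallery_rel ::
    "(real ^ 'n) set \<Rightarrow> (real ^ 'n \<Rightarrow> nat) \<Rightarrow> ((real ^ 'n) set \<times> (real ^ 'n) set) set" where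
  "gallery_rel V \<omega> =
     {(r, s). r \<in> rays V \<and> s \<in> rays V \<and> (r = s \<or> {r, s} \<in> Gly V \<omega>)}"

definition gallery_classes ::
    "(real ^ 'n) set \<Rightarrow> (real ^ 'n \<Rightarrow> nat) \<Rightarrow> (real ^ 'n) set set set" where
  "gallery_classes V \<omega> = rays V // gallery_rel V \<omega>"

end

theory Submission
  imports Defs
begin

text \<open>
  An integral non-negative function has intersection number 1 with the fan iff it takes the value 1
  on a single primitive generator, of weight 1, and vanishes on the others. By balancing and the
  spanning hypothesis, \<open>max(0, l)\<close> has intersection number at least 1 for every non-zero \<open>l\<close> in the
  dual lattice. So if \<open>M = max(0, l\<^sub>1, \<dots>, l\<^sub>m)\<close> has intersection number 1 and \<open>M(v\<^sub>i) = 1\<close>, each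
  non-zero \<open>l\<^sub>s\<close> is the functional of a gallery containing the ray of \<open>v\<^sub>i\<close>, hence one of the
  \<open>l\<^sub>i\<^sub>j\<close>. Conversely \<open>M\<^sub>m\<^sub>a\<^sub>x(i)\<close> has intersection number 1, concentrated at \<open>v\<^sub>i\<close>, and any non-zero \<open>M\<close>
  below it has intersection number at least 1.
\<close>

section \<open>Rays and their primitive generators\<close>

text \<open>In each coordinate \<open>n * x = m * y\<close> with \<open>m\<close>, \<open>n\<close>
  coprime, so \<open>n\<close> divides \<open>y\<close>. This removes the denominator when two
  lattice vectors have ratio \<open>m / n\<close>.\<close>

lemma integral_vector_scaleR_nat_div:
  assumes "integral_vector a" "integral_vector b" "of_nat n *\<^sub>R a = of_nat m *\<^sub>R b"
    and "coprime m n" "n \<noteq> 0"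
  shows "integral_vector ((1 / of_nat n) *\<^sub>R b)"
  unfolding integral_vector_def
proof
  fix i
  obtain x y where x: "a $ i = of_int x" and y: "b $ i = of_int y"
    using assms(1,2) unfolding integral_vector_def Ints_def by blast
  have "of_nat n * a $ i = of_nat m * b $ i"
    using arg_cong[OF assms(3), of "\<lambda>w. w $ i"] by simp
  then have "int n * x = int m * y"
    unfolding x y by (metis of_int_eq_iff of_int_mult of_int_of_nat_eq)
  then have "int n dvd int m * y"
    by (metis dvd_triv_left)
  then have "int n dvd y"
    using assms(4) by (simp add: coprime_commute coprime_dvd_mult_right_iff)
  then obtain z where "y = int n * z" ..
  then have "((1 / of_nat n) *\<^sub>R b) $ i = of_int z"
    using y assms(5) by simp
  then show "((1 / of_nat n) *\<^sub>R b) $ i \<in> \<int>"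
    by simp
qed

text \<open>The factor \<open>t\<close> with \<open>a = t *\<^sub>R b\<close> is a quotient of
  integer coordinates, hence a reduced fraction \<open>m / n\<close>. Primitivity of
  \<open>b\<close> forces \<open>n = 1\<close>, then primitivity of \<open>a\<close> forces
  \<open>m = 1\<close>. This allows passing freely between rays and generators.\<close>

lemma ray_primitive_inj:
  assumes a: "primitive_vector a" and b: "primitive_vector b" and eq: "ray a = ray b"
  shows "a = b"
proof -
  have "a \<in> ray b"
    unfolding eq[symmetric] by (auto simp: ray_def intro!: exI[of _ 1])
  then obtain t where t: "a = t *\<^sub>R b" "t \<ge> 0"
    unfolding ray_def by blast
  have int: "integral_vector a" "integral_vector b" and "b \<noteq> 0"
    using a b by (auto simp: primitive_vector_def)
  then obtain i where i: "b $ i \<noteq> 0"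
    by (metis vec_eq_iff zero_index)
  have "t = a $ i / b $ i"
    using t i by simp
  moreover have "a $ i \<in> \<rat>" "b $ i \<in> \<rat>"
    using int Ints_subset_Rats unfolding integral_vector_def by blast+
  ultimately have "t \<in> \<rat>"
    by simp
  then obtain m n :: nat where mn: "n \<noteq> 0" "\<bar>t\<bar> = m / n" "coprime m n"
    by (rule Rats_abs_nat_div_natE)
  then have t_eq: "t = m / n"
    using t by simp
  then have "of_nat n *\<^sub>R a = of_nat m *\<^sub>R b"
    using t mn by simp
  then have "integral_vector ((1 / of_nat n) *\<^sub>R b)"
    using integral_vector_scaleR_nat_div int mn by blast
  moreover have "b = of_nat n *\<^sub>R ((1 / of_nat n) *\<^sub>R b)"
    using mn by simp
  ultimately have "n = 1"
    using b unfolding primitive_vector_def by blast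
  then have "a = of_nat m *\<^sub>R b"
    using t t_eq by simp
  moreover from this have "m = 1"
    using a int unfolding primitive_vector_def by blast
  ultimately show ?thesis
    by simp
qed

lemma span_Union_rays: "span (\<Union>(rays V)) = span V"
proof (rule span_eq[THEN iffD2], intro conjI subsetI)
  fix x assume "x \<in> \<Union>(rays V)"
  then show "x \<in> span V"
    by (auto simp: rays_def ray_def intro: span_scale span_base)
next
  fix x assume "x \<in> V"
  then have "x \<in> \<Union>(rays V)"
    by (auto simp: rays_def ray_def intro!: bexI[of _ x] exI[of _ "1::real"])
  then show "x \<in> span (\<Union>(rays V))"
    by (rule span_base)
qed

section \<open>Integral functionals and balancing\<close>

lemma dual_lattice_uminus: "l \<in> dual_lattice \<Longrightarrow> (\<lambda>x. - l x) \<in> dual_lattice"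
  by (auto simp: dual_lattice_def intro: linear_compose_neg)

lemma dual_lattice_add:
  "l \<in> dual_lattice \<Longrightarrow> l' \<in> dual_lattice \<Longrightarrow> (\<lambda>x. l x + l' x) \<in> dual_lattice"
  by (auto simp: dual_lattice_def intro: linear_compose_add)

lemma dual_lattice_eqI:
  assumes "l \<in> dual_lattice" "l' \<in> dual_lattice" "span V = UNIV"
    and "\<And>v. v \<in> V \<Longrightarrow> l v = l' v"
  shows "l = l'"
proof
  fix x
  show "l x = l' x"
    using assms linear_eq_on_span[of l l' V x] by (auto simp: dual_lattice_def)
qed

lemma dual_lattice_Ints:
  "tropical_fan V \<omega> \<Longrightarrow> l \<in> dual_lattice \<Longrightarrow> v \<in> V \<Longrightarrow> l v \<in> \<int>"
  by (auto simp: tropical_fan_def primitive_vector_def dual_lattice_def)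

lemma tropical_fan_balanced:
  assumes "tropical_fan V \<omega>" "l \<in> dual_lattice"
  shows "(\<Sum>v\<in>V. of_nat (\<omega> v) * l v) = 0"
proof -
  have l: "linear l"
    using assms(2) by (simp add: dual_lattice_def)
  have "(\<Sum>v\<in>V. of_nat (\<omega> v) * l v) = l (\<Sum>v\<in>V. of_nat (\<omega> v) *\<^sub>R v)"
    by (simp add: linear_sum[OF l] linear_scale[OF l])
  then show ?thesis
    using assms(1) linear_0[OF l] by (simp add: tropical_fan_def)
qed

section \<open>Intersection numbers with the fan\<close>

lemma intersection_number_mono:
  assumes "\<And>v. v \<in> V \<Longrightarrow> M v \<le> N v"
  shows "intersection_number M V \<omega> \<le> intersection_number N V \<omega>"
  unfolding intersection_number_def by (intro sum_mono mult_left_mono assms) auto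

text \<open>A sum of non-negative integers equals 1 only if one summand is 1 and the others are 0; a
  product of naturals equal to 1 has both factors 1, and positive weights turn zero summands into
  zeros of \<open>M\<close>.\<close>

lemma intersection_number_eq_1E:
  assumes fan: "tropical_fan V \<omega>" and "intersection_number M V \<omega> = 1"
    and M: "\<And>v. v \<in> V \<Longrightarrow> M v \<in> \<int>" "\<And>v. v \<in> V \<Longrightarrow> 0 \<le> M v"
  obtains a where "a \<in> V" "\<omega> a = 1" "M a = 1" "\<And>v. v \<in> V \<Longrightarrow> v \<noteq> a \<Longrightarrow> M v = 0"
proof -
  have fin: "finite V" and pos: "\<And>v. v \<in> V \<Longrightarrow> \<omega> v > 0"
    using fan by (auto simp: tropical_fan_def)
  \<comment> \<open>The values are recast as naturals so that the library criterion for a sum to be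
    \<open>Suc 0\<close> applies.\<close>
  define g where "g v = nat \<lfloor>M v\<rfloor>" for v
  have g: "M v = of_nat (g v)" if "v \<in> V" for v
    using M[OF that] by (auto simp: g_def Ints_def)
  have "real (\<Sum>v\<in>V. \<omega> v * g v) = 1"
    using assms(2) by (simp add: intersection_number_def g)
  then have "(\<Sum>v\<in>V. \<omega> v * g v) = Suc 0"
    by linarith
  then obtain a where a: "a \<in> V" "\<omega> a * g a = Suc 0" "\<forall>v\<in>V. a \<noteq> v \<longrightarrow> \<omega> v * g v = 0"
    unfolding sum_eq_Suc0_iff[OF fin] by blast
  show thesis
  proof (rule that)
    show "a \<in> V" "\<omega> a = 1" "M a = 1"
      using a g by auto
    show "M v = 0" if "v \<in> V" "v \<noteq> a" for v
      using a(3) that g pos[OF that(1)] by fastforce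
  qed
qed

lemma intersection_number_single:
  assumes "finite V" "a \<in> V" "\<And>v. v \<in> V \<Longrightarrow> v \<noteq> a \<Longrightarrow> M v = 0"
  shows "intersection_number M V \<omega> = of_nat (\<omega> a) * M a"
proof -
  have "intersection_number M V \<omega> = (\<Sum>v\<in>{a}. of_nat (\<omega> v) * M v)"
    unfolding intersection_number_def using assms by (intro sum.mono_neutral_right) auto
  then show ?thesis
    by simp
qed

text \<open>The intersection number is a non-negative integer. If it were 0, \<open>l\<close> would
  be non-positive on all generators; balancing would then make it vanish there, and spanning would
  give \<open>l = 0\<close>.\<close>

lemma intersection_number_max_ge_1:
  assumes fan: "tropical_fan V \<omega>" and l: "l \<in> dual_lattice" and span: "span V = UNIV"
    and "l \<noteq> (\<lambda>x. 0)"
  shows "intersection_number (\<lambda>x. max 0 (l x)) V \<omega> \<ge> 1"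
proof (rule ccontr)
  have fin: "finite V" and pos: "\<And>v. v \<in> V \<Longrightarrow> \<omega> v > 0"
    using fan by (auto simp: tropical_fan_def)
  assume "\<not> ?thesis"
  moreover have "intersection_number (\<lambda>x. max 0 (l x)) V \<omega> \<in> \<int>"
    unfolding intersection_number_def
    using dual_lattice_Ints[OF fan l] by (intro Ints_sum Ints_mult) (auto simp: max_def)
  moreover have "intersection_number (\<lambda>x. max 0 (l x)) V \<omega> \<ge> 0"
    unfolding intersection_number_def by (intro sum_nonneg) auto
  ultimately have "intersection_number (\<lambda>x. max 0 (l x)) V \<omega> = 0"
    by (auto simp: Ints_def)
  then have "\<forall>v\<in>V. of_nat (\<omega> v) * max 0 (l v) = 0"
    unfolding intersection_number_def by (subst (asm) sum_nonneg_eq_0_iff[OF fin]) auto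
  then have le: "l v \<le> 0" if "v \<in> V" for v
    using that pos[OF that] by fastforce
  \<comment> \<open>The sign is flipped to make all summands non-negative, so that each of them
    vanishes.\<close>
  have "(\<Sum>v\<in>V. - (of_nat (\<omega> v) * l v)) = 0"
    using tropical_fan_balanced[OF fan l] by (simp add: sum_negf)
  then have "\<forall>v\<in>V. - (of_nat (\<omega> v) * l v) = 0"
    using le by (subst (asm) sum_nonneg_eq_0_iff[OF fin]) (auto simp: mult_nonneg_nonpos)
  then have "l v = 0" if "v \<in> V" for v
    using that pos[OF that] by auto
  then have "l = (\<lambda>x. 0)"
    using l span by (intro dual_lattice_eqI[of _ _ V]) (auto simp: dual_lattice_def linear_zero)
  with assms(4) show False ..
qed

section \<open>Galleries and gallery classes\<close>

text \<open>\<open>max 0 (- t) = max 0 t - t\<close>, and the contribution of the last term is zero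
  by balancing.\<close>

lemma gallery_functionals_uminus:
  assumes fan: "tropical_fan V \<omega>" and "l \<in> gallery_functionals V \<omega>"
  shows "(\<lambda>x. - l x) \<in> gallery_functionals V \<omega>"
proof -
  have l: "l \<in> dual_lattice" "intersection_number (\<lambda>x. max 0 (l x)) V \<omega> = 1"
    using assms by (auto simp: gallery_functionals_def)
  have "of_nat (\<omega> v) * max 0 (- l v) = of_nat (\<omega> v) * max 0 (l v) - of_nat (\<omega> v) * l v" for v
    by (simp add: max_def)
  then have "intersection_number (\<lambda>x. max 0 (- l x)) V \<omega> = 1"
    using l(2) tropical_fan_balanced[OF fan l(1)]
    by (simp add: intersection_number_def sum_subtractf)
  then show ?thesis
    using l(1) by (simp add: gallery_functionals_def dual_lattice_uminus)
qed

text \<open>Both the positive and the negative part of \<open>l\<close> have intersection number 1,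
  so each is concentrated on a single generator of weight 1.\<close>

lemma gallery_functionalsE:
  assumes fan: "tropical_fan V \<omega>" and l: "l \<in> gallery_functionals V \<omega>"
  obtains a b where "a \<in> V" "b \<in> V" "\<omega> a = 1" "\<omega> b = 1" "l a = 1" "l b = - 1"
    "\<And>v. v \<in> V \<Longrightarrow> v \<noteq> a \<Longrightarrow> v \<noteq> b \<Longrightarrow> l v = 0"
proof -
  have *: "l \<in> dual_lattice" "intersection_number (\<lambda>x. max 0 (l x)) V \<omega> = 1"
    "intersection_number (\<lambda>x. max 0 (- l x)) V \<omega> = 1"
    using l gallery_functionals_uminus[OF assms] by (auto simp: gallery_functionals_def)
  have int: "max 0 (l v) \<in> \<int>" "max 0 (- l v) \<in> \<int>" if "v \<in> V" for v
    using dual_lattice_Ints[OF fan *(1) that] by (auto simp: max_def)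
  obtain a where a: "a \<in> V" "\<omega> a = 1" "max 0 (l a) = 1"
    "\<And>v. v \<in> V \<Longrightarrow> v \<noteq> a \<Longrightarrow> max 0 (l v) = 0"
    using intersection_number_eq_1E[OF fan *(2) int(1) max.cobounded1] by blast
  obtain b where b: "b \<in> V" "\<omega> b = 1" "max 0 (- l b) = 1"
    "\<And>v. v \<in> V \<Longrightarrow> v \<noteq> b \<Longrightarrow> max 0 (- l v) = 0"
    using intersection_number_eq_1E[OF fan *(3) int(2) max.cobounded1] by blast
  show thesis
  proof (rule that[OF a(1) b(1) a(2) b(2)])
    show "l a = 1" "l b = - 1"
      using a(3) b(3) by (auto simp: max_def split: if_splits)
    show "l v = 0" if "v \<in> V" "v \<noteq> a" "v \<noteq> b" for v
      using a(4)[OF that(1,2)] b(4)[OF that(1,3)] by (auto simp: max_def split: if_splits)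
  qed
qed

text \<open>Reduces galleries to values on generators, which makes negation, addition and uniqueness
  of gallery functionals pointwise checks on \<open>V\<close>.\<close>

lemma is_gallery_iff:
  assumes fan: "tropical_fan V \<omega>"
  shows "is_gallery V \<omega> l a b \<longleftrightarrow>
    l \<in> dual_lattice \<and> a \<in> V \<and> b \<in> V \<and> \<omega> a = 1 \<and> \<omega> b = 1 \<and> l a = 1 \<and> l b = - 1 \<and>
    (\<forall>v\<in>V. v \<noteq> a \<longrightarrow> v \<noteq> b \<longrightarrow> l v = 0)" (is "_ \<longleftrightarrow> ?R")
proof
  assume g: "is_gallery V \<omega> l a b"
  then have l: "l \<in> gallery_functionals V \<omega>" and ab: "a \<in> V" "b \<in> V" "l a = 1" "l b = - 1"
    by (auto simp: is_gallery_def)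
  obtain a' b' where *: "a' \<in> V" "b' \<in> V" "\<omega> a' = 1" "\<omega> b' = 1" "l a' = 1" "l b' = - 1"
    "\<And>v. v \<in> V \<Longrightarrow> v \<noteq> a' \<Longrightarrow> v \<noteq> b' \<Longrightarrow> l v = 0"
    using gallery_functionalsE[OF fan l] by blast
  \<comment> \<open>The value 1 is taken only at \<open>a'\<close> and the value -1 only at
    \<open>b'\<close>.\<close>
  have "a = a'" "b = b'"
    using *(5-7) ab by force+
  then show ?R
    using * l by (auto simp: gallery_functionals_def)
next
  assume R: ?R
  have "intersection_number (\<lambda>x. max 0 (l x)) V \<omega> = of_nat (\<omega> a) * max 0 (l a)"
    using R fan by (intro intersection_number_single) (auto simp: tropical_fan_def max_def)
  moreover have "{v \<in> V. \<bar>l v\<bar> = 1} = {a, b}"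
    using R by force
  then have "gallery V l = ray ` {a, b}"
    unfolding gallery_def by blast
  ultimately show "is_gallery V \<omega> l a b"
    using R by (simp add: is_gallery_def gallery_functionals_def)
qed

lemma is_gallery_uminus:
  "tropical_fan V \<omega> \<Longrightarrow> is_gallery V \<omega> l a b \<Longrightarrow> is_gallery V \<omega> (\<lambda>x. - l x) b a"
  by (auto simp: is_gallery_iff dual_lattice_uminus)

text \<open>At the common generator \<open>b\<close> the values -1 and 1 cancel. With
  \<open>a = c\<close> the values at \<open>a\<close> would cancel as well, hence the
  inequality.\<close>

lemma is_gallery_trans:
  assumes "tropical_fan V \<omega>" "is_gallery V \<omega> l a b" "is_gallery V \<omega> l' b c" "a \<noteq> c"
  shows "is_gallery V \<omega> (\<lambda>x. l x + l' x) a c"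
proof -
  note g = assms(2,3)[unfolded is_gallery_iff[OF assms(1)]]
  have "a \<noteq> b" "b \<noteq> c"
    using g by auto
  then have "l' a = 0" "l c = 0"
    using g assms(4) by auto
  moreover have "l x + l' x = 0" if "x \<in> V" "x \<noteq> a" "x \<noteq> c" for x
    using g that by (cases "x = b") auto
  ultimately show ?thesis
    using g unfolding is_gallery_iff[OF assms(1)] by (simp add: dual_lattice_add)
qed

text \<open>The values on \<open>V\<close> are prescribed by the ordered pair, and \<open>V\<close>
  spans; so the definite description has exactly one candidate.\<close>

lemma gallery_functional_eq:
  assumes "tropical_fan V \<omega>" "span V = UNIV" "is_gallery V \<omega> l a b"
  shows "gallery_functional V \<omega> a b = l"
  unfolding gallery_functional_def
proof (rule the_equality[of _ l])
  fix l' assume l': "is_gallery V \<omega> l' a b"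
  then show "l' = l"
    using assms(2,3) unfolding is_gallery_iff[OF assms(1)]
    by (intro dual_lattice_eqI[of l' l V]) metis+
qed (rule assms)

text \<open>A member of \<open>Gly\<close> is an unordered pair of rays. Injectivity of
  \<open>ray\<close> on \<open>V\<close> recovers the pair of generators, and replacing
  \<open>l\<close> by its negative gives the other ordering.\<close>

lemma Gly_iff:
  assumes fan: "tropical_fan V \<omega>" and ab: "a \<in> V" "b \<in> V"
  shows "{ray a, ray b} \<in> Gly V \<omega> \<longleftrightarrow> (\<exists>l. is_gallery V \<omega> l a b)"
proof
  assume "{ray a, ray b} \<in> Gly V \<omega>"
  then obtain l where l: "l \<in> gallery_functionals V \<omega>" and eq: "gallery V l = {ray a, ray b}"
    by (auto simp: Gly_def)
  obtain a' b' where *: "a' \<in> V" "b' \<in> V" "\<omega> a' = 1" "\<omega> b' = 1" "l a' = 1" "l b' = - 1"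
    "\<And>v. v \<in> V \<Longrightarrow> v \<noteq> a' \<Longrightarrow> v \<noteq> b' \<Longrightarrow> l v = 0"
    using gallery_functionalsE[OF fan l] by blast
  have g: "is_gallery V \<omega> l a' b'"
    using * l by (auto simp: is_gallery_iff[OF fan] gallery_functionals_def)
  have "inj_on ray V"
    using fan ray_primitive_inj by (auto simp: inj_on_def tropical_fan_def)
  moreover have "ray ` {a, b} = ray ` {a', b'}"
    using g eq by (simp add: is_gallery_def)
  ultimately have "{a, b} = {a', b'}"
    using ab *(1,2) by (meson empty_subsetI inj_on_image_eq_iff insert_subset)
  then have "a = a' \<and> b = b' \<or> a = b' \<and> b = a'"
    by (auto simp: doubleton_eq_iff)
  then show "\<exists>l. is_gallery V \<omega> l a b"
    using g is_gallery_uminus[OF fan] by blast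
next
  assume "\<exists>l. is_gallery V \<omega> l a b"
  then show "{ray a, ray b} \<in> Gly V \<omega>"
    unfolding is_gallery_def Gly_def by (metis imageI)
qed

text \<open>\<open>P\<close> is the class of some \<open>ray c\<close>; symmetry and transitivity of
  forming a gallery move the base point from \<open>c\<close> to \<open>a\<close>.\<close>

lemma gallery_class_mem_iff:
  assumes fan: "tropical_fan V \<omega>" and P: "P \<in> gallery_classes V \<omega>"
    and a: "a \<in> V" "ray a \<in> P" and b: "b \<in> V" "a \<noteq> b"
  shows "ray b \<in> P \<longleftrightarrow> (\<exists>l. is_gallery V \<omega> l a b)"
proof -
  have inj: "ray x = ray y \<longleftrightarrow> x = y" if "x \<in> V" "y \<in> V" for x y
    using fan that ray_primitive_inj by (auto simp: tropical_fan_def)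
  obtain c where c: "c \<in> V" "P = gallery_rel V \<omega> `` {ray c}"
    using P by (auto simp: gallery_classes_def quotient_def rays_def)
  have mem: "ray x \<in> P \<longleftrightarrow> c = x \<or> (\<exists>l. is_gallery V \<omega> l c x)" if "x \<in> V" for x
    using that c inj[OF c(1) that] Gly_iff[OF fan c(1) that]
    by (auto simp: gallery_rel_def rays_def)
  define gal where "gal x y \<longleftrightarrow> (\<exists>l. is_gallery V \<omega> l x y)" for x y
  have "gal y x" if "gal x y" for x y
    using that is_gallery_uminus[OF fan] unfolding gal_def by blast
  \<comment> \<open>\<open>gal\<close> is irreflexive, a functional being unable to take both values
    1 and -1 at one point; transitivity therefore needs distinct ends.\<close>
  moreover have "gal x z" if "gal x y" "gal y z" "x \<noteq> z" for x y z
    using that is_gallery_trans[OF fan] unfolding gal_def by blast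
  ultimately show ?thesis
    using mem[OF a(1)] mem[OF b(1)] a(2) b(2) unfolding gal_def[symmetric] by metis
qed

section \<open>Non-negative TR functions\<close>

lemma Max_insert_0_le_iff:
  fixes f :: "'a \<Rightarrow> real"
  assumes "finite L"
  shows "Max (insert 0 (f ` L)) \<le> c \<longleftrightarrow> 0 \<le> c \<and> (\<forall>l\<in>L. f l \<le> c)"
  using assms by (subst Max_le_iff) auto

lemma Max_insert_0_ge:
  fixes f :: "'a \<Rightarrow> real"
  assumes "finite L"
  shows "0 \<le> Max (insert 0 (f ` L))" "l \<in> L \<Longrightarrow> f l \<le> Max (insert 0 (f ` L))"
  using assms by (auto intro!: Max_ge)

text \<open>The maximum is attained by 0 or by one of the finitely many functionals, all integral on
  generators.\<close>

lemma nonneg_TR_Ints: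
  assumes "tropical_fan V \<omega>" "nonneg_TR M" "v \<in> V"
  shows "M v \<in> \<int>"
proof -
  obtain L where L: "finite L" "L \<subseteq> dual_lattice" "M = (\<lambda>x. Max (insert 0 ((\<lambda>l. l x) ` L)))"
    using assms(2) unfolding nonneg_TR_def by blast
  have "M v \<in> insert 0 ((\<lambda>l. l v) ` L)"
    unfolding L(3) using L(1) by (intro Max_in) auto
  then show ?thesis
    using dual_lattice_Ints[OF assms(1) _ assms(3)] L(2) by auto
qed

text \<open>A non-zero \<open>M\<close> has a non-zero functional \<open>l\<close> among those
  defining it, and \<open>M\<close> dominates \<open>max 0 l\<close>.\<close>

lemma nonneg_TR_intersection_number_ge_1:
  assumes "tropical_fan V \<omega>" "span V = UNIV" "nonneg_TR M" "M \<noteq> (\<lambda>x. 0)"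
  shows "intersection_number M V \<omega> \<ge> 1"
proof -
  obtain L where L: "finite L" "L \<subseteq> dual_lattice" "M = (\<lambda>x. Max (insert 0 ((\<lambda>l. l x) ` L)))"
    using assms(3) unfolding nonneg_TR_def by blast
  have "\<exists>l\<in>L. l \<noteq> (\<lambda>x. 0)"
  proof (rule ccontr)
    assume "\<not> ?thesis"
    then have "M x = 0" for x
      unfolding L(3) by (intro Max_eqI) (auto simp: L(1))
    with assms(4) show False
      by auto
  qed
  then obtain l where l: "l \<in> L" "l \<noteq> (\<lambda>x. 0)"
    by blast
  then have "1 \<le> intersection_number (\<lambda>x. max 0 (l x)) V \<omega>"
    using intersection_number_max_ge_1 assms(1,2) L(2) by blast
  also have "\<dots> \<le> intersection_number M V \<omega>"
    unfolding L(3) using l(1)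
    by (intro intersection_number_mono max.boundedI Max_insert_0_ge[OF L(1)])
  finally show ?thesis .
qed

section \<open>Non-negative TR functions concentrated on one ray of a gallery class\<close>

theorem theorem3p11:
  fixes V :: "(real ^ 'n) set" and \<omega> :: "real ^ 'n \<Rightarrow> nat"
    and P :: "(real ^ 'n) set set" and v :: "nat \<Rightarrow> real ^ 'n" and k :: nat
    and l :: "nat \<Rightarrow> nat \<Rightarrow> real ^ 'n \<Rightarrow> real"
    and Mmax :: "nat \<Rightarrow> real ^ 'n \<Rightarrow> real"
  assumes "tropical_fan V \<omega>"
    and "span (\<Union>(rays V)) = UNIV"
    and "P \<in> gallery_classes V \<omega>" and "card P \<ge> 2"
    and "v ` {0..k} \<subseteq> V" and "inj_on v {0..k}" and "P = (\<lambda>i. ray (v i)) ` {0..k}"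
  defines "l \<equiv> \<lambda>i j. gallery_functional V \<omega> (v i) (v j)"
    and "Mmax \<equiv> \<lambda>i x. Max (insert 0 ((\<lambda>j. l i j x) ` ({0..k} - {i})))"
  shows "\<forall>i\<in>{0..k}.
    {M. nonneg_TR M \<and> intersection_number M V \<omega> = 1 \<and> M (v i) = 1} =
    {M. nonneg_TR M \<and> (\<forall>x. 0 \<le> M x) \<and> M \<noteq> (\<lambda>x. 0) \<and> (\<forall>x. M x \<le> Mmax i x)}"
proof
  have fan: "tropical_fan V \<omega>" and span: "span V = UNIV"
    using assms(1,2) by (simp_all add: span_Union_rays)
  have fin: "finite V"
    using fan by (simp add: tropical_fan_def)
  fix i assume i: "i \<in> {0..k}"
  have vi: "v i \<in> V" "ray (v i) \<in> P"
    using i assms(5,7) by auto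
  have l: "is_gallery V \<omega> (l i j) (v i) (v j)" if j: "j \<in> {0..k} - {i}" for j
  proof -
    have "v j \<in> V" "ray (v j) \<in> P" "v i \<noteq> v j"
      using i j assms(5-7) by (auto dest: inj_onD)
    then obtain l' where "is_gallery V \<omega> l' (v i) (v j)"
      using gallery_class_mem_iff[OF fan assms(3) vi] by blast
    then show ?thesis
      unfolding l_def using gallery_functional_eq[OF fan span] by simp
  qed
  \<comment> \<open>Conversely, \<open>P\<close> is a full class, so a gallery starting at
    \<open>v i\<close> must end at some \<open>v j\<close>; uniqueness then identifies its
    functional.\<close>
  have l_eq: "\<exists>j\<in>{0..k} - {i}. l' = l i j" if g: "is_gallery V \<omega> l' (v i) b" for l' b
  proof -
    have "b \<in> V" "v i \<noteq> b"
      using g by (auto simp: is_gallery_def)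
    then have "ray b \<in> P"
      using gallery_class_mem_iff[OF fan assms(3) vi] g by blast
    then obtain j where j: "j \<in> {0..k}" "ray b = ray (v j)"
      using assms(7) by blast
    then have "b = v j"
      using fan assms(5) \<open>b \<in> V\<close> by (intro ray_primitive_inj) (simp_all add: tropical_fan_def image_subset_iff)
    then show ?thesis
      using j g \<open>v i \<noteq> b\<close> gallery_functional_eq[OF fan span g] by (auto simp: l_def)
  qed
  show "{M. nonneg_TR M \<and> intersection_number M V \<omega> = 1 \<and> M (v i) = 1} =
    {M. nonneg_TR M \<and> (\<forall>x. 0 \<le> M x) \<and> M \<noteq> (\<lambda>x. 0) \<and> (\<forall>x. M x \<le> Mmax i x)}"
  proof (intro set_eqI iffI; elim CollectE conjE; intro CollectI conjI)
    fix M :: "real ^ 'n \<Rightarrow> real"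
    assume M: "nonneg_TR M" "intersection_number M V \<omega> = 1" "M (v i) = 1"
    obtain L where L: "finite L" "L \<subseteq> dual_lattice" "M = (\<lambda>x. Max (insert 0 ((\<lambda>l. l x) ` L)))"
      using M(1) unfolding nonneg_TR_def by blast
    have nonneg: "0 \<le> M x" for x
      unfolding L(3) by (rule Max_insert_0_ge[OF L(1)])
    then show "\<forall>x. 0 \<le> M x" ..
    show "M \<noteq> (\<lambda>x. 0)"
      using M(3) by auto
    obtain a where "a \<in> V" "M a = 1" "\<And>w. w \<in> V \<Longrightarrow> w \<noteq> a \<Longrightarrow> M w = 0"
      using intersection_number_eq_1E[OF fan M(2)] nonneg_TR_Ints[OF fan M(1)] nonneg by metis
    \<comment> \<open>The single generator carrying \<open>M\<close> is \<open>v i\<close>, where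
      \<open>M\<close> is non-zero.\<close>
    then have M0: "M w = 0" if "w \<in> V" "w \<noteq> v i" for w
      using that M(3) vi(1) by (metis zero_neq_one)
    have L_cases: "l' = (\<lambda>x. 0) \<or> (\<exists>j\<in>{0..k} - {i}. l' = l i j)" if l': "l' \<in> L" for l'
    proof (unfold disj_imp, rule impI)
      assume "l' \<noteq> (\<lambda>x. 0)"
      have le: "l' x \<le> M x" for x
        unfolding L(3) by (rule Max_insert_0_ge(2)[OF L(1) l'])
      \<comment> \<open>Lying below \<open>M\<close> bounds the intersection number by 1 from above,
        being non-zero bounds it from below; so \<open>l'\<close> defines a gallery.\<close>
      have "intersection_number (\<lambda>x. max 0 (l' x)) V \<omega> \<le> 1"
        unfolding M(2)[symmetric] using le nonneg by (intro intersection_number_mono) simp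
      moreover have "intersection_number (\<lambda>x. max 0 (l' x)) V \<omega> \<ge> 1"
        using intersection_number_max_ge_1[OF fan _ span \<open>l' \<noteq> (\<lambda>x. 0)\<close>] l' L(2) by blast
      ultimately have gf: "l' \<in> gallery_functionals V \<omega>"
        using l' L(2) by (auto simp: gallery_functionals_def)
      obtain a b where ab: "a \<in> V" "b \<in> V" "\<omega> a = 1" "\<omega> b = 1" "l' a = 1" "l' b = - 1"
        "\<And>w. w \<in> V \<Longrightarrow> w \<noteq> a \<Longrightarrow> w \<noteq> b \<Longrightarrow> l' w = 0"
        using gallery_functionalsE[OF fan gf] by blast
      \<comment> \<open>\<open>M\<close> is at least \<open>l' a = 1\<close> at \<open>a\<close>,
        but vanishes at every generator other than \<open>v i\<close>.\<close>
      have "a = v i"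
        using M0[OF ab(1)] le[of a] ab(5) by force
      then have "is_gallery V \<omega> l' (v i) b"
        using ab l' L(2) by (auto simp: is_gallery_iff[OF fan])
      then show "\<exists>j\<in>{0..k} - {i}. l' = l i j"
        by (rule l_eq)
    qed
    show "\<forall>x. M x \<le> Mmax i x"
    proof
      fix x
      have "0 \<le> Mmax i x" "\<And>j. j \<in> {0..k} - {i} \<Longrightarrow> l i j x \<le> Mmax i x"
        unfolding Mmax_def by (auto intro!: Max_insert_0_ge simp del: Max_insert)
      then show "M x \<le> Mmax i x"
        unfolding L(3) Max_insert_0_le_iff[OF L(1)] using L_cases by fastforce
    qed
  next
    fix M :: "real ^ 'n \<Rightarrow> real"
    assume M: "nonneg_TR M" "\<forall>x. 0 \<le> M x" "M \<noteq> (\<lambda>x. 0)" "\<forall>x. M x \<le> Mmax i x"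
    have Mmax_le: "M x \<le> c" if "0 \<le> c" "\<And>j. j \<in> {0..k} - {i} \<Longrightarrow> l i j x \<le> c" for x c
    proof -
      have "Mmax i x \<le> c"
        unfolding Mmax_def using that by (subst Max_insert_0_le_iff) auto
      then show ?thesis
        using M(4) order_trans by blast
    qed
    \<comment> \<open>With no index besides \<open>i\<close>, the bound \<open>Mmax i\<close> would
      be zero and \<open>M\<close> with it. An index \<open>j\<close> is wanted because its gallery
      gives \<open>v i\<close> weight 1.\<close>
    have ne: "{0..k} - {i} \<noteq> {}"
    proof
      assume "{0..k} - {i} = {}"
      then have "M x \<le> 0" for x
        by (intro Mmax_le) auto
      then have "M x = 0" for x
        using M(2) by (simp add: antisym)
      then show False
        using M(3) by auto
    qed
    then obtain j where "j \<in> {0..k} - {i}"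
      by blast
    then have wi: "\<omega> (v i) = 1"
      using l is_gallery_iff[OF fan] by blast
    \<comment> \<open>Away from \<open>v i\<close> each \<open>l i j\<close> is 0 or -1 on
      generators, so \<open>M\<close> is squeezed between 0 and 0.\<close>
    have Mw: "M w = 0" if "w \<in> V" "w \<noteq> v i" for w
    proof -
      have "l i j w \<le> 0" if "j \<in> {0..k} - {i}" for j
        using l[OF that] \<open>w \<in> V\<close> \<open>w \<noteq> v i\<close> unfolding is_gallery_iff[OF fan]
        by (cases "w = v j") auto
      then show ?thesis
        using Mmax_le[of 0 w] M(2) by (simp add: antisym)
    qed
    \<comment> \<open>Every \<open>l i j\<close> equals 1 at \<open>v i\<close>. Since the
      intersection number is just \<open>M (v i)\<close>, this upper bound meets the lower bound 1
      for non-zero TR functions.\<close>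
    have "M (v i) \<le> 1"
      using l by (intro Mmax_le) (auto simp: is_gallery_def)
    moreover have eq: "intersection_number M V \<omega> = M (v i)"
      using intersection_number_single[where M = M, OF fin vi(1) Mw] wi by simp
    moreover have "intersection_number M V \<omega> \<ge> 1"
      using nonneg_TR_intersection_number_ge_1[OF fan span M(1,3)] .
    ultimately show "M (v i) = 1" "intersection_number M V \<omega> = 1"
      by auto
  qed
qed

end
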